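(* Let $M,N\ge 1$ be integers, let $\mathbf g_m,\mathbf f_m\in\mathbb C^{N\times 1}$ with $\mathbf f_m\neq \mathbf 0$ and $P_m>0$ for $m=1,\dots,M$, let $q\in\mathbb C$, $\alpha\ge 0$, $\sigma^2>0$, and let $R_{\mathrm{th}}$ be a real number. Write $\mathbf g^T=[\mathbf g_1^T,\dots,\mathbf g_M^T]$, $\mathbf f^T=[\mathbf f_1^T,\dots,\mathbf f_M^T]$ and $\mathbf w^T=[\mathbf w_1^T,\dots,\mathbf w_M^T]$ with $\mathbf w_m\in\mathbb C^{N\times 1}$. Consider the optimization problem $$\max_{\mathbf w\in\mathbb C^{MN\times 1}}\ |\mathbf f^H\mathbf w|^2\quad\text{subject to}\quad \log_2\Big(1+\frac{|\mathbf g^H\mathbf w|^2}{\alpha|q|^2|\mathbf f^H\mathbf w|^2+\sigma^2}\Big)\ge R_{\mathrm{th}},\qquad \|\mathbf w_m\|^2\le P_m,\ m=1,\dots,M .$$ Define $$\widehat R_s=\log_2\left(1+\frac{\Big|\sum_{m=1}^M\sqrt{P_m}\,\frac{\mathbf g_m^H\mathbf f_m}{\|\mathbf f_m\|}\Big|^2}{\alpha|q|^2\Big|\sum_{m=1}^M\sqrt{P_m}\,\|\mathbf f_m\|\Big|^2+\sigma^2}\right).$$ If $R_{\mathrm{th}}\le\widehat R_s$, then the vector $\mathbf w^\star$ with blocks $$\mathbf w_m^\star=\sqrt{P_m}\,\frac{\mathbf f_m}{\|\mathbf f_m\|},\qquad m=1,\dots,M,$$ is an optimal solution of this problem, and the optimal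 objective value is $$|\mathbf f^H\mathbf w^\star|^2=\Big(\sum_{m=1}^M\sqrt{P_m}\,\|\mathbf f_m\|\Big)^2 .$$
   Context: $(\cdot)^T$ and $(\cdot)^H$ denote transpose and Hermitian (conjugate) transpose, and $\|\cdot\|$ is the Euclidean norm. Interpretation (not needed for the claim): $\mathbf g_m,\mathbf f_m$ are the channels from the $m$th of $M$ access points (each with $N$ antennas) to a receiver and to a backscatter device, $q$ is the channel coefficient from the backscatter device to the receiver, $\alpha$ is the power reflection coefficient, $\sigma^2$ the noise power, $P_m$ the maximum transmit power of access point $m$, and $R_{\mathrm{th}}$ the target primary communication rate. *)

theory Defs
  imports "HOL-Analysis.Analysis"
begin

text \<open>
  \<open>M\<close> and \<open>N\<close> are the cardinalities of the finite index types \<open>'m\<close> (access points) and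
  \<open>'n\<close> (antennas), so that \<open>complex ^ ('m \<times> 'n)\<close> is the space of stacked vectors of
  dimension \<open>M N\<close>. The library norm on \<open>complex ^ 'n\<close> is the Euclidean norm.
\<close>

text \<open>The product \<open>x\<^sup>H y\<close>: conjugate-linear in the first argument. The inner product \<open>\<bullet>\<close>
  of the library is its real part only.\<close>

definition herm :: "complex ^ 'k \<Rightarrow> complex ^ 'k \<Rightarrow> complex" where
  "herm x y = (\<Sum>i\<in>UNIV. cnj (x $ i) * y $ i)"

definition stack :: "('m::finite \<Rightarrow> complex ^ 'n) \<Rightarrow> complex ^ ('m \<times> 'n)" where
  "stack v = (\<chi> p. v (fst p) $ snd p)"

definition block :: "complex ^ ('m::finite \<times> 'n) \<Rightarrow> 'm \<Rightarrow> complex ^ 'n" where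
  "block w m = (\<chi> i. w $ (m, i))"

lemma block_stack [simp]: "block (stack v) m = v m"
  by (simp add: block_def stack_def vec_eq_iff)

lemma stack_block [simp]: "stack (block w) = w"
  by (simp add: block_def stack_def vec_eq_iff)

definition objective ::
  "('m::finite \<Rightarrow> complex ^ 'n) \<Rightarrow> complex ^ ('m \<times> 'n) \<Rightarrow> real" where
  "objective f w = (cmod (herm (stack f) w))\<^sup>2"

definition primary_rate ::
  "('m::finite \<Rightarrow> complex ^ 'n) \<Rightarrow> ('m \<Rightarrow> complex ^ 'n) \<Rightarrow> complex \<Rightarrow> real \<Rightarrow> real
    \<Rightarrow> complex ^ ('m \<times> 'n) \<Rightarrow> real" where
  "primary_rate g f q \<alpha> \<sigma> w =
     log 2 (1 + (cmod (herm (stack g) w))\<^sup>2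
                / (\<alpha> * (cmod q)\<^sup>2 * (cmod (herm (stack f) w))\<^sup>2 + \<sigma>\<^sup>2))"

definition feasible ::
  "('m::finite \<Rightarrow> complex ^ 'n) \<Rightarrow> ('m \<Rightarrow> complex ^ 'n) \<Rightarrow> complex \<Rightarrow> real \<Rightarrow> real
    \<Rightarrow> ('m \<Rightarrow> real) \<Rightarrow> real \<Rightarrow> complex ^ ('m \<times> 'n) \<Rightarrow> bool" where
  "feasible g f q \<alpha> \<sigma> P Rth w \<longleftrightarrow>
     primary_rate g f q \<alpha> \<sigma> w \<ge> Rth \<and> (\<forall>m. (norm (block w m))\<^sup>2 \<le> P m)"

definition R_hat ::
  "('m::finite \<Rightarrow> complex ^ 'n) \<Rightarrow> ('m \<Rightarrow> complex ^ 'n) \<Rightarrow> complex \<Rightarrow> real \<Rightarrow> real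
    \<Rightarrow> ('m \<Rightarrow> real) \<Rightarrow> real" where
  "R_hat g f q \<alpha> \<sigma> P =
     log 2 (1 + (cmod (\<Sum>m\<in>UNIV. of_real (sqrt (P m)) * (herm (g m) (f m) / of_real (norm (f m)))))\<^sup>2
                / (\<alpha> * (cmod q)\<^sup>2 * \<bar>\<Sum>m\<in>UNIV. sqrt (P m) * norm (f m)\<bar>\<^sup>2 + \<sigma>\<^sup>2))"

definition w_star ::
  "('m::finite \<Rightarrow> complex ^ 'n) \<Rightarrow> ('m \<Rightarrow> real) \<Rightarrow> complex ^ ('m \<times> 'n)" where
  "w_star f P = stack (\<lambda>m. (sqrt (P m) / norm (f m)) *\<^sub>R f m)"

end

(* Since f^H w is the sum of the f_m^H w_m, Cauchy-Schwarz on every block bounds the objective on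
   the power constraints alone. Matching each w_m to f_m at full power attains the bound, and the
   rate of that vector is exactly R_hat, so the rate constraint costs nothing. *)
theory Submission
  imports Defs
begin

text \<open>Cauchy-Schwarz for the full complex product, not only its real part: the triangle
  inequality passes to the moduli of the entries, where the real inequality for
  \<open>L2_set\<close> applies.\<close>

lemma norm_herm_le: "cmod (herm x y) \<le> norm x * norm y"
proof -
  have "cmod (herm x y) \<le> (\<Sum>i\<in>UNIV. \<bar>cmod (x $ i)\<bar> * \<bar>cmod (y $ i)\<bar>)"
    unfolding herm_def by (rule sum_norm_le) (simp add: norm_mult)
  also have "\<dots> \<le> norm x * norm y"
    unfolding norm_vec_def by (rule L2_set_mult_ineq)
  finally show ?thesis .
qed

lemma herm_self: "herm x x = of_real ((norm x)\<^sup>2)"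
proof -
  have "herm x x = (\<Sum>i\<in>UNIV. of_real ((cmod (x $ i))\<^sup>2))"
    unfolding herm_def by (intro sum.cong refl) (simp only: complex_norm_square mult.commute)
  then show ?thesis
    by (simp add: norm_vec_def L2_set_def sum_nonneg)
qed

lemma herm_scaleR_right: "herm x (c *\<^sub>R y) = of_real c * herm x y"
  by (simp add: herm_def sum_distrib_left scaleR_conv_of_real[where 'a=complex] mult.left_commute)

text \<open>Splitting the sum over index pairs into a double sum decouples the access points, which
  the power constraints bound one by one.\<close>

lemma herm_stack: "herm (stack g) w = (\<Sum>m\<in>UNIV. herm (g m) (block w m))"
  by (simp add: herm_def stack_def block_def sum.cartesian_product case_prod_unfold
      flip: UNIV_Times_UNIV)

text \<open>Kept general in \<open>g\<close>, as it serves both the numerator of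
  \<open>R_hat\<close> and, with \<open>g = f\<close>, the objective.\<close>

lemma herm_stack_w_star:
  "herm (stack g) (w_star f P) =
    (\<Sum>m\<in>UNIV. of_real (sqrt (P m)) * (herm (g m) (f m) / of_real (norm (f m))))"
  by (simp add: herm_stack w_star_def herm_scaleR_right)

text \<open>Matching cancels all phases, since \<open>herm (f m) (f m)\<close> is the real number
  \<open>(norm (f m))\<^sup>2\<close>. A zero block gives 0 on both sides, division by 0 being
  0.\<close>

lemma herm_stack_self_w_star:
  "herm (stack f) (w_star f P) = of_real (\<Sum>m\<in>UNIV. sqrt (P m) * norm (f m))"
  by (simp add: herm_stack_w_star herm_self power2_eq_square)
    (rule sum.cong, auto)

lemma objective_w_star:
  "objective f (w_star f P) = (\<Sum>m\<in>UNIV. sqrt (P m) * norm (f m))\<^sup>2"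
  unfolding objective_def herm_stack_self_w_star by (simp only: norm_of_real power2_abs)

lemma primary_rate_w_star: "primary_rate g f q \<alpha> \<sigma> (w_star f P) = R_hat g f q \<alpha> \<sigma> P"
  \<comment> \<open>The product with \<open>f\<close> is rewritten first because
    \<open>herm_stack_w_star\<close> matches it too; \<open>norm_of_real\<close> then yields the
    absolute value in the denominator of \<open>R_hat\<close>.\<close>
  unfolding primary_rate_def R_hat_def herm_stack_self_w_star
  by (simp only: herm_stack_w_star norm_of_real)

lemma norm_block_w_star:
  assumes "f m \<noteq> 0" and "P m \<ge> 0"
  shows "(norm (block (w_star f P) m))\<^sup>2 = P m"
  using assms by (simp add: w_star_def)

text \<open>Bound for the relaxation to the power constraints: triangle inequality across blocks,
  Cauchy-Schwarz within each.\<close>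

lemma objective_le:
  assumes "\<And>m. (norm (block w m))\<^sup>2 \<le> P m"
  shows "objective f w \<le> (\<Sum>m\<in>UNIV. sqrt (P m) * norm (f m))\<^sup>2"
proof -
  have "cmod (herm (stack f) w) \<le> (\<Sum>m\<in>UNIV. sqrt (P m) * norm (f m))"
    unfolding herm_stack
  proof (rule sum_norm_le)
    fix m
    have "norm (block w m) \<le> sqrt (P m)"
      using assms by (rule real_le_rsqrt)
    then have "norm (f m) * norm (block w m) \<le> sqrt (P m) * norm (f m)"
      by (simp add: mult.commute[of "norm (f m)"] mult_right_mono)
    with norm_herm_le show "cmod (herm (f m) (block w m)) \<le> sqrt (P m) * norm (f m)"
      by (rule order_trans)
  qed
  then show ?thesis
    unfolding objective_def by (simp add: power_mono)
qed

theorem theorem1: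
  fixes g f :: "'m::finite \<Rightarrow> complex ^ 'n"
    and P :: "'m \<Rightarrow> real"
    and q :: complex
    and \<alpha> \<sigma> Rth :: real
  assumes "\<And>m. f m \<noteq> 0"
    and "\<And>m. P m > 0"
    and "\<alpha> \<ge> 0"
    and "\<sigma>\<^sup>2 > 0"
    and "Rth \<le> R_hat g f q \<alpha> \<sigma> P"
  shows "is_arg_max (objective f) (feasible g f q \<alpha> \<sigma> P Rth) (w_star f P)
    \<and> (SUP w\<in>{w. feasible g f q \<alpha> \<sigma> P Rth w}. objective f w) = objective f (w_star f P)
    \<and> objective f (w_star f P) = (\<Sum>m\<in>UNIV. sqrt (P m) * norm (f m))\<^sup>2"
proof -
  have feas: "feasible g f q \<alpha> \<sigma> P Rth (w_star f P)"
    using assms by (simp add: feasible_def primary_rate_w_star norm_block_w_star less_imp_le)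
  have le: "objective f w \<le> objective f (w_star f P)" if "feasible g f q \<alpha> \<sigma> P Rth w" for w
    using that unfolding objective_w_star feasible_def by (blast intro: objective_le)
  have "is_arg_max (objective f) (feasible g f q \<alpha> \<sigma> P Rth) (w_star f P)"
    using feas le by (simp add: is_arg_max_linorder)
  \<comment> \<open>The bound is attained at a feasible point, so this real supremum is a genuine
    maximum.\<close>
  moreover have "(SUP w\<in>{w. feasible g f q \<alpha> \<sigma> P Rth w}. objective f w) = objective f (w_star f P)"
    using feas le by (intro cSup_eq_maximum) auto
  ultimately show ?thesis
    using objective_w_star by blast
qed

end
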